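(* Let $n$ be a positive integer, let $u,v,w\in[n]^*$ with $w$ non-empty, and let $y$ be the least letter occurring in $w$. Suppose that $|w|_y\geq|v|$ and that for each letter $x$ occurring in $v$ and each letter $z$ occurring in $u$ we have $x<y$ and $y\leq z$. Then $wuv\equiv_{\rm gram}wvu$.
   Context: Write $[n]=\{1<2<\cdots<n\}$, $[n]^*$ for the free monoid on $[n]$, $\mathbb{N}_0$ for the non-negative integers; $|v|$ is the length of the word $v$ and $|w|_y$ the number of occurrences of $y$ in $w$. Grammic congruence: each letter $a\in[n]$ acts on $\mathbb{N}_0^n$ on the right: for $\gamma\in\mathbb{N}_0^n$ let $t=\min\{s\in[n]: s>a,\ \gamma_s>0\}$ if this set is non-empty; then $\gamma\cdot a=\gamma+e_a-e_t$ if $t$ is defined, and $\gamma\cdot a=\gamma+e_a$ otherwise, where $e_i$ is the $i$th standard basis vector. This extends to words by $\gamma\cdot\varepsilon=\gamma$ and $\gamma\cdot(w_1\cdots w_k)=(\cdots(\gamma\cdot w_1)\cdots)\cdot w_k$. For $u,v\in[n]^*$, $u\equiv_{\rm gram}v$ means $\gamma\cdot u=\gamma\cdot v$ for all $\gamma\in\mathbb{N}_0^n$. *)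

theory Defs
  imports Main "HOL-Library.FuncSet"
begin

abbreviation letters :: "nat \<Rightarrow> nat set" where
  "letters n \<equiv> {1..n}"

abbreviation words :: "nat \<Rightarrow> nat list set" where
  "words n \<equiv> lists (letters n)"

(* Vectors in N_0^n are extensional functions on {1..n}, so that equality of functions in this set
   is equality of the n coordinates. *)
definition vectors :: "nat \<Rightarrow> (nat \<Rightarrow> nat) set" where
  "vectors n = letters n \<rightarrow>\<^sub>E UNIV"

definition larger_support :: "nat \<Rightarrow> (nat \<Rightarrow> nat) \<Rightarrow> nat \<Rightarrow> nat set" where
  "larger_support n \<gamma> a = {s \<in> letters n. s > a \<and> \<gamma> s > 0}"

(* Since t = Min (larger_support n \<gamma> a) differs from a and satisfies \<gamma> t > 0, the update below is
   \<gamma> + e_a - e_t and the subtraction on nat does not truncate. *)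
definition gram_act_letter :: "nat \<Rightarrow> (nat \<Rightarrow> nat) \<Rightarrow> nat \<Rightarrow> (nat \<Rightarrow> nat)" where
  "gram_act_letter n \<gamma> a =
    (if larger_support n \<gamma> a \<noteq> {}
     then let t = Min (larger_support n \<gamma> a) in \<gamma>(a := \<gamma> a + 1, t := \<gamma> t - 1)
     else \<gamma>(a := \<gamma> a + 1))"

definition gram_act :: "nat \<Rightarrow> (nat \<Rightarrow> nat) \<Rightarrow> nat list \<Rightarrow> (nat \<Rightarrow> nat)" where
  "gram_act n \<gamma> w = foldl (gram_act_letter n) \<gamma> w"

(* Intended for u, v in words n only. *)
definition gram_cong :: "nat \<Rightarrow> nat list \<Rightarrow> nat list \<Rightarrow> bool" where
  "gram_cong n u v \<longleftrightarrow> (\<forall>\<gamma> \<in> vectors n. gram_act n \<gamma> u = gram_act n \<gamma> v)"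

end

theory Submission
  imports Defs
begin

text \<open>
  A letter never decreases a coordinate below or at itself. Hence, after \<open>w\<close> has acted, the
  coordinate at \<open>y\<close> is at least \<open>|w|\<^sub>y\<close>. While this coordinate is positive, a letter \<open>x < y\<close>
  decreases a coordinate in \<open>{x<..y}\<close>, whereas a letter \<open>z \<ge> y\<close> decreases one above \<open>z\<close>, so
  neither choice influences the other and the two letters commute. Each letter of \<open>v\<close> lowers the
  coordinate at \<open>y\<close> by at most one and the letters of \<open>u\<close> do not lower it, so it suffices that
  it starts at \<open>|v|\<close> or more.
\<close>

lemma finite_larger_support [simp]: "finite (larger_support n \<gamma> a)"
  by (simp add: larger_support_def)

lemma Min_larger_support:
  assumes "larger_support n \<gamma> a \<noteq> {}"
  shows "a < Min (larger_support n \<gamma> a)" "0 < \<gamma> (Min (larger_support n \<gamma> a))"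
  using Min_in[OF finite_larger_support assms] by (auto simp: larger_support_def)

lemma Min_larger_support_le:
  assumes "y \<in> letters n" "a < y" "0 < \<gamma> y"
  shows "Min (larger_support n \<gamma> a) \<le> y"
  using assms by (intro Min_le) (auto simp: larger_support_def)

lemma gram_act_Nil [simp]: "gram_act n \<gamma> [] = \<gamma>"
  and gram_act_Cons [simp]: "gram_act n \<gamma> (a # w) = gram_act n (gram_act_letter n \<gamma> a) w"
  and gram_act_append: "gram_act n \<gamma> (v @ w) = gram_act n (gram_act n \<gamma> v) w"
  by (simp_all add: gram_act_def)

lemma gram_act_letter_below:
  assumes "y \<le> a"
  shows "gram_act_letter n \<gamma> a y = (if y = a then \<gamma> y + 1 else \<gamma> y)"
proof (cases "larger_support n \<gamma> a = {}")
  case False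
  with assms Min_larger_support(1)[OF False] show ?thesis
    unfolding gram_act_letter_def Let_def by (simp del: Min_gr_iff)
qed (simp add: gram_act_letter_def)

lemma gram_act_letter_ge_pred: "\<gamma> y - 1 \<le> gram_act_letter n \<gamma> a y"
  using Min_larger_support[of n \<gamma> a]
  by (auto simp: gram_act_letter_def Let_def)

lemma gram_act_ge_count_list:
  assumes "\<forall>a \<in> set w. y \<le> a"
  shows "\<gamma> y + count_list w y \<le> gram_act n \<gamma> w y"
  using assms
proof (induction w arbitrary: \<gamma>)
  case (Cons a w)
  then have "gram_act_letter n \<gamma> a y + count_list w y \<le> gram_act n (gram_act_letter n \<gamma> a) w y"
    by simp
  with gram_act_letter_below[of y a n \<gamma>] Cons.prems show ?case
    by (auto split: if_splits)
qed simp

text \<open>With \<open>t\<close> and \<open>s\<close> the coordinates lowered by \<open>x\<close>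
  and \<open>z\<close> (\<open>s\<close> may not exist), \<open>x < t \<le> y \<le> z < s\<close>.
  The changes can only overlap if \<open>t = y = z\<close>; there \<open>0 < \<gamma> t\<close>
  makes lowering and raising by one commute despite truncated subtraction.\<close>

lemma gram_act_letter_commute:
  assumes y: "y \<in> letters n" "0 < \<gamma> y" and xz: "x < y" "y \<le> z"
  shows "gram_act_letter n (gram_act_letter n \<gamma> x) z = gram_act_letter n (gram_act_letter n \<gamma> z) x"
proof -
  define t where "t = Min (larger_support n \<gamma> x)"
  have ne: "larger_support n \<gamma> x \<noteq> {}"
    using y xz by (auto simp: larger_support_def)
  have t: "x < t" "t \<le> y" "0 < \<gamma> t"
    using Min_larger_support[OF ne] Min_larger_support_le[of y n x \<gamma>] y xz by (auto simp: t_def)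
  have x: "gram_act_letter n \<gamma> x = \<gamma>(x := \<gamma> x + 1, t := \<gamma> t - 1)"
    using ne by (simp add: gram_act_letter_def t_def Let_def)
  \<comment> \<open>The action of \<open>x\<close> changes only coordinates at or below
    \<open>y\<close>, hence none above \<open>z\<close>.\<close>
  have supp_z: "larger_support n (gram_act_letter n \<gamma> x) z = larger_support n \<gamma> z"
    using t xz by (auto simp: x larger_support_def)
  define \<delta> where "\<delta> = gram_act_letter n \<gamma> z"
  have \<delta>_le: "\<delta> s = (if s = z then \<gamma> s + 1 else \<gamma> s)" if "s \<le> y" for s
    using that xz by (simp add: \<delta>_def gram_act_letter_below)
  have t_mem: "t \<in> larger_support n \<delta> x"
    using t y xz \<delta>_le[of t] Min_in[OF finite_larger_support ne]
    by (auto simp: larger_support_def t_def)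
  \<comment> \<open>Below \<open>y\<close> the vectors \<delta> and \<gamma> agree, so no smaller
    candidate than \<open>t\<close> appears there; any candidate from \<open>y\<close> on is at
    least \<open>t\<close> anyway.\<close>
  have Min_\<delta>: "Min (larger_support n \<delta> x) = t"
  proof (rule Min_eqI)
    fix s assume s: "s \<in> larger_support n \<delta> x"
    show "t \<le> s"
    proof (cases "s < y")
      case True
      then have "s \<in> larger_support n \<gamma> x"
        using s \<delta>_le[of s] xz by (auto simp: larger_support_def)
      then show ?thesis by (simp add: t_def)
    qed (use t in simp)
  qed (use t_mem in auto)
  have z: "gram_act_letter n \<delta> x = \<delta>(x := \<delta> x + 1, t := \<delta> t - 1)"
    using t_mem by (auto simp: gram_act_letter_def Min_\<delta> Let_def)
  show ?thesis
  proof (cases "larger_support n \<gamma> z = {}")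
    case True
    then have "\<delta> = \<gamma>(z := \<gamma> z + 1)"
      "gram_act_letter n (gram_act_letter n \<gamma> x) z =
        (gram_act_letter n \<gamma> x)(z := gram_act_letter n \<gamma> x z + 1)"
      using supp_z by (simp_all add: \<delta>_def gram_act_letter_def[of n _ z])
    then show ?thesis
      using z t xz by (auto simp: \<delta>_def[symmetric] x)
  next
    case False
    define s where "s = Min (larger_support n \<gamma> z)"
    have "\<delta> = \<gamma>(z := \<gamma> z + 1, s := \<gamma> s - 1)"
      "gram_act_letter n (gram_act_letter n \<gamma> x) z = (gram_act_letter n \<gamma> x)
        (z := gram_act_letter n \<gamma> x z + 1, s := gram_act_letter n \<gamma> x s - 1)"
      using False supp_z by (simp_all add: \<delta>_def gram_act_letter_def[of n _ z] s_def Let_def)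
    moreover have "z < s"
      using Min_larger_support(1)[OF False] by (simp only: s_def)
    ultimately show ?thesis
      using z t xz by (auto simp: \<delta>_def[symmetric] x fun_eq_iff)
  qed
qed

lemma gram_act_letter_word_commute:
  assumes "y \<in> letters n" "0 < \<gamma> y" "x < y" "\<forall>z \<in> set u. y \<le> z"
  shows "gram_act n (gram_act_letter n \<gamma> x) u = gram_act_letter n (gram_act n \<gamma> u) x"
  using assms
proof (induction u arbitrary: \<gamma>)
  case (Cons z u)
  \<comment> \<open>Positivity at \<open>y\<close> survives \<open>z\<close>, so the induction
    hypothesis applies to the new vector.\<close>
  have "0 < gram_act_letter n \<gamma> z y"
    using gram_act_letter_below[of y z n \<gamma>] Cons.prems by auto
  with Cons gram_act_letter_commute[of y n \<gamma> x z] show ?case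
    by simp
qed simp

text \<open>Induction on \<open>v\<close>: its first letter is moved across \<open>u\<close>, and
  the at most one unit it costs at \<open>y\<close> matches the drop in the length of
  \<open>v\<close>.\<close>

lemma gram_act_word_commute:
  assumes "y \<in> letters n" "length v \<le> \<gamma> y" "\<forall>x \<in> set v. x < y" "\<forall>z \<in> set u. y \<le> z"
  shows "gram_act n \<gamma> (u @ v) = gram_act n \<gamma> (v @ u)"
  using assms
proof (induction v arbitrary: \<gamma>)
  case (Cons x v)
  have "length v \<le> gram_act_letter n \<gamma> x y"
    using gram_act_letter_ge_pred[of \<gamma> y n x] Cons.prems by simp
  with Cons have "gram_act n (gram_act_letter n \<gamma> x) (u @ v) = gram_act n (gram_act_letter n \<gamma> x) (v @ u)"
    by simp
  moreover have "0 < \<gamma> y"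
    using Cons.prems by auto
  ultimately show ?case
    using gram_act_letter_word_commute[of y n \<gamma> x u] Cons.prems by (simp add: gram_act_append)
qed simp

theorem proposition6p1:
  fixes n y :: nat and u v w :: "nat list"
  assumes "n \<ge> 1"
    and "u \<in> words n" and "v \<in> words n" and "w \<in> words n"
    and "w \<noteq> []"
    and "y = Min (set w)"
    and "count_list w y \<ge> length v"
    and "\<forall>x \<in> set v. \<forall>z \<in> set u. x < y \<and> y \<le> z"
  shows "gram_cong n (w @ u @ v) (w @ v @ u)"
\<comment> \<open>The last hypothesis bounds letters in pairs, so it splits into separate bounds on
  \<open>v\<close> and \<open>u\<close> once both are non-empty; otherwise the two words
  coincide.\<close>
proof (cases "u = [] \<or> v = []")
  case False
  have "y \<in> set w"
    using assms(5,6) by simp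
  then have y: "y \<in> letters n"
    using assms(4) by auto
  have ge: "length v \<le> gram_act n \<gamma> w y" for \<gamma>
    using gram_act_ge_count_list[of w y \<gamma> n] assms(6,7) by simp
  have "\<forall>x \<in> set v. x < y" "\<forall>z \<in> set u. y \<le> z"
    using assms(8) False by (meson list.set_intros(1) neq_Nil_conv set_empty equals0I)+
  then show ?thesis
    using gram_act_word_commute[of y n v "gram_act n \<gamma> w" u for \<gamma>, OF y ge]
    by (simp add: gram_cong_def gram_act_append)
qed (auto simp: gram_cong_def)

end
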